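(* Let $n\geq 5$ and $m=\binom{n}{2}-1$ be integers. Let $Z_n$ be the three-terminal graph with vertex set $\{z_1,\dots,z_n\}$, target vertices $r=z_1$, $s=z_2$, $t=z_3$, and edge set $$E(Z_n)=\{z_iz_j : 1\leq i<j\leq n\}\setminus\{z_4z_5\}.$$ Then $Z_n$ is the unique (up to isomorphism of three-terminal graphs) uniformly most reliable graph in $\mathcal{G}_{n,m}$.
   Context: A three-terminal graph is a graph with three specified distinct vertices $r,s,t$, called target vertices. $\mathcal{G}_{n,m}$ denotes the set of all simple three-terminal graphs with $n$ vertices and $m$ edges. An isomorphism of three-terminal graphs is a graph isomorphism mapping the set of target vertices onto the set of target vertices. For $G\in\mathcal{G}_{n,m}$ and $p\in[0,1]$, the three-terminal reliability $R_3(G;p)$ is the probability that $r,s,t$ all lie in one connected component of the random spanning subgraph of $G$ in which each edge survives independently with probability $p$. Equivalently, $R_3(G;p)=\sum_{i=2}^{m}N_i(G)p^i(1-p)^{m-i}$, where $N_i(G)$ is the number of $i$-element subsets of $E(G)$ such that $r,s,t$ are all connected to each other using only those edges. A graph $G\in\mathcal{G}_{n,m}$ is a uniformly most reliable graph in $\mathcal{G}_{n,m}$ if $R_3(G;p)\geq R_3(H;p)$ for all $H\in\mathcal{G}_{n,m}$ and all $0\leq p\leq 1$. *)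

theory Defs
  imports "HOL-Probability.Probability"
begin

(* Edges are two-element sets of vertices. *)
record 'a tt_graph =
  verts :: "'a set"
  edges :: "'a set set"
  target_r :: 'a
  target_s :: 'a
  target_t :: 'a

definition targets :: "'a tt_graph \<Rightarrow> 'a set" where
  "targets G = {target_r G, target_s G, target_t G}"

definition simple_tt_graph :: "'a tt_graph \<Rightarrow> bool" where
  "simple_tt_graph G \<longleftrightarrow>
     finite (verts G) \<and>
     edges G \<subseteq> {{u, v} | u v. u \<in> verts G \<and> v \<in> verts G \<and> u \<noteq> v} \<and>
     targets G \<subseteq> verts G \<and>
     distinct [target_r G, target_s G, target_t G]"

definition tt_graphs :: "nat \<Rightarrow> nat \<Rightarrow> 'a tt_graph set" where
  "tt_graphs n m = {G. simple_tt_graph G \<and> card (verts G) = n \<and> card (edges G) = m}"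

definition tt_isomorphic :: "'a tt_graph \<Rightarrow> 'b tt_graph \<Rightarrow> bool" where
  "tt_isomorphic G H \<longleftrightarrow>
     (\<exists>f. bij_betw f (verts G) (verts H) \<and>
          (\<forall>u\<in>verts G. \<forall>v\<in>verts G. {u, v} \<in> edges G \<longleftrightarrow> {f u, f v} \<in> edges H) \<and>
          f ` targets G = targets H)"

definition connected_using :: "'a set set \<Rightarrow> 'a \<Rightarrow> 'a \<Rightarrow> bool" where
  "connected_using F u v \<longleftrightarrow> (u, v) \<in> {(x, y). {x, y} \<in> F}\<^sup>*"

definition targets_connected :: "'a tt_graph \<Rightarrow> 'a set set \<Rightarrow> bool" where
  "targets_connected G F \<longleftrightarrow>
     (\<forall>u\<in>targets G. \<forall>v\<in>targets G. connected_using F u v)"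

(* The distribution of the set of surviving edges.  The value False of Pi_pmf
   outside the finite set edges G is a dummy. *)
definition surviving_edges :: "'a tt_graph \<Rightarrow> real \<Rightarrow> 'a set set pmf" where
  "surviving_edges G p =
     map_pmf (\<lambda>survives. {e \<in> edges G. survives e})
       (Pi_pmf (edges G) False (\<lambda>_. bernoulli_pmf p))"

definition reliability3 :: "'a tt_graph \<Rightarrow> real \<Rightarrow> real" where
  "reliability3 G p = measure_pmf.prob (surviving_edges G p) {F. targets_connected G F}"

definition uniformly_most_reliable :: "nat \<Rightarrow> nat \<Rightarrow> 'a tt_graph \<Rightarrow> bool" where
  "uniformly_most_reliable n m G \<longleftrightarrow>
     G \<in> tt_graphs n m \<and>
     (\<forall>H\<in>(tt_graphs n m :: 'a tt_graph set). \<forall>p\<in>{0..1}. reliability3 G p \<ge> reliability3 H p)"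

definition Z_graph :: "nat \<Rightarrow> (nat \<Rightarrow> 'a) \<Rightarrow> 'a tt_graph" where
  "Z_graph n z =
     \<lparr>verts = z ` {1..n},
      edges = {{z i, z j} | i j. 1 \<le> i \<and> i < j \<and> j \<le> n} - {{z 4, z 5}},
      target_r = z 1, target_s = z 2, target_t = z 3\<rparr>"

(* The number of i-element edge sets that connect the targets. *)
definition num_connecting :: "'a tt_graph \<Rightarrow> nat \<Rightarrow> nat" where
  "num_connecting G i = card {F. F \<subseteq> edges G \<and> card F = i \<and> targets_connected G F}"

lemma finite_edges:
  assumes "simple_tt_graph G"
  shows "finite (edges G)"
proof -
  have "edges G \<subseteq> Pow (verts G)"
    using assms by (auto simp: simple_tt_graph_def)
  then show ?thesis
    using assms by (meson finite_Pow_iff finite_subset simple_tt_graph_def)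
qed

lemma pmf_surviving_edges:
  assumes "finite (edges G)" "F \<subseteq> edges G" "p \<in> {0..1}"
  shows "pmf (surviving_edges G p) F = p ^ card F * (1 - p) ^ (card (edges G) - card F)"
proof -
  let ?P = "Pi_pmf (edges G) False (\<lambda>_. bernoulli_pmf p)"
  have "pmf (surviving_edges G p) F = measure_pmf.prob ?P ((\<lambda>f. {e \<in> edges G. f e}) -` {F})"
    by (simp add: surviving_edges_def pmf_map)
  also have "\<dots> = measure_pmf.prob ?P {\<lambda>e. e \<in> F}"
  proof (rule measure_pmf.finite_measure_eq_AE)
    show "AE f in measure_pmf ?P. f \<in> (\<lambda>f. {e \<in> edges G. f e}) -` {F} \<longleftrightarrow> f \<in> {\<lambda>e. e \<in> F}"
    proof (rule AE_pmfI)
      fix f assume "f \<in> set_pmf ?P"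
      then have "f \<in> {f. \<forall>x. x \<notin> edges G \<longrightarrow> f x = False}"
        using set_Pi_pmf_subset[OF assms(1), of False "\<lambda>_. bernoulli_pmf p"] by auto
      then show "f \<in> (\<lambda>f. {e \<in> edges G. f e}) -` {F} \<longleftrightarrow> f \<in> {\<lambda>e. e \<in> F}"
        using assms(2) by (auto simp: fun_eq_iff)
    qed
  qed auto
  also have "\<dots> = pmf ?P (\<lambda>e. e \<in> F)"
    by (simp add: measure_pmf_single)
  also have "\<dots> = (\<Prod>e\<in>edges G. pmf (bernoulli_pmf p) (e \<in> F))"
    using assms by (subst pmf_Pi) auto
  also have "\<dots> = (\<Prod>e\<in>edges G. if e \<in> F then p else 1 - p)"
    using assms(3) by (intro prod.cong) auto
  also have "\<dots> = p ^ card F * (1 - p) ^ card (edges G - F)"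
    using assms(1,2) by (simp add: prod.If_cases Int_absorb1 Diff_eq)
  finally show ?thesis
    using assms by (simp add: card_Diff_subset finite_subset)
qed

lemma reliability3_eq_sum_num_connecting:
  assumes "simple_tt_graph G" "p \<in> {0..1}"
  shows "reliability3 G p =
    (\<Sum>i\<le>card (edges G). real (num_connecting G i) * p ^ i * (1 - p) ^ (card (edges G) - i))"
proof -
  have fin: "finite (edges G)" using assms(1) by (rule finite_edges)
  let ?A = "{F. F \<subseteq> edges G \<and> targets_connected G F}"
  let ?m = "card (edges G)"
  have finA: "finite ?A" using fin by simp
  have "reliability3 G p = measure_pmf.prob (surviving_edges G p) ?A"
    unfolding reliability3_def
    by (rule measure_pmf.finite_measure_eq_AE) (auto intro!: AE_pmfI simp: surviving_edges_def)
  also have "\<dots> = (\<Sum>F\<in>?A. pmf (surviving_edges G p) F)"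
    using finA by (rule measure_measure_pmf_finite)
  also have "\<dots> = (\<Sum>F\<in>?A. p ^ card F * (1 - p) ^ (?m - card F))"
    using fin assms(2) by (intro sum.cong) (auto simp: pmf_surviving_edges)
  also have "\<dots> = (\<Sum>i\<le>?m. \<Sum>F\<in>{F \<in> ?A. card F = i}. p ^ card F * (1 - p) ^ (?m - card F))"
    using fin finA by (intro sum.group[symmetric]) (auto intro: card_mono)
  also have "\<dots> = (\<Sum>i\<le>?m. real (num_connecting G i) * p ^ i * (1 - p) ^ (?m - i))"
  proof (rule sum.cong[OF refl])
    fix i
    have "{F \<in> ?A. card F = i} = {F. F \<subseteq> edges G \<and> card F = i \<and> targets_connected G F}"
      by auto
    then show "(\<Sum>F\<in>{F \<in> ?A. card F = i}. p ^ card F * (1 - p) ^ (?m - card F)) =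
        real (num_connecting G i) * p ^ i * (1 - p) ^ (?m - i)"
      by (simp add: num_connecting_def)
  qed
  finally show ?thesis .
qed

end

theory Submission
  imports Defs
begin

text \<open>
  A graph with \<open>n\<close> vertices and \<open>(n choose 2) - 1\<close> edges is a complete graph \<open>K\<close> with one pair
  deleted, and up to isomorphism only the position of that pair matters: two targets, a target
  and a nontarget, or two nontargets.  The last case is \<open>Z_graph\<close>.

  Let a random edge set of \<open>K\<close> keep each edge with probability \<open>p < 1\<close>, and call a pair \<open>e\<close> pivotal if
  the targets are not joined, but would be after adding \<open>e\<close>.  Then \<open>(1 - p) (R(K) - R(K - e))\<close> is
  \<open>p\<close> times the probability that \<open>e\<close> is pivotal (\<open>expect_delete\<close>), so the best pair to delete is the one
  least likely to be pivotal.  Take targets \<open>r, s, t\<close> and nontargets \<open>x, y\<close>, write \<open>ab|cd\<close> for the event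
  that \<open>a, b\<close> share a component and \<open>c, d\<close> share a different one, and let \<open>q\<close> be the probability of
  \<open>abc|de\<close>, which by symmetry is the same for all five distinct vertices.

  \<^item> If \<open>xy\<close> is pivotal, then two targets and one of \<open>x, y\<close> are in one component and the other
    target and the other nontarget are in another.  These six events have total probability \<open>6 q\<close>.

  \<^item> If \<open>rt|s\<close> or \<open>st|r\<close>, then \<open>rs\<close> is pivotal.  Placing \<open>x\<close> and \<open>y\<close> in the two components, in the three
    ways that give a split of type three to two, makes six disjoint events of probability \<open>q\<close>.

  \<^item> If \<open>rsx|t\<close> or \<open>rx|st\<close> or \<open>sx|rt\<close>, then \<open>tx\<close> is pivotal.  Placing \<open>y\<close> in one of the two
    components gives only five events of probability \<open>q\<close>, and the event that \<open>rsx|t\<close> and \<open>y\<close> is not with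
    \<open>t\<close>.  So this case needs that, given \<open>abc|d\<close>, a fifth vertex is no likelier to be with \<open>d\<close> than not to
    be with \<open>d\<close>.

  This last inequality is the heart of the proof (\<open>expect_split_3_2_le\<close>).  It does not hold
  component by component, because the component of \<open>d\<close> may be the larger one.  Remove the fifth vertex \<open>w\<close>, and let
  \<open>A\<close> and \<open>D\<close> be the components of \<open>a\<close> and \<open>d\<close> in the rest.  If \<open>w\<close> ends up with \<open>d\<close>, it has no edge to
  \<open>A\<close>; if it has no edge to \<open>D\<close>, it is not with \<open>d\<close>.  The probabilities are \<open>(1 - p) ^ |A|\<close> and
  \<open>(1 - p) ^ |D|\<close>, so one must compare their means over the event \<open>abc|d\<close>.  On this event \<open>A\<close> tends to
  be the larger component: it holds three of the four vertices.  In detail, average over the choice of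
  \<open>b\<close> and \<open>c\<close>, which turns the event into the weight \<open>(|A| - 1) (|A| - 2)\<close>, and exchange \<open>a\<close> and \<open>d\<close>; the
  rest is the rearrangement inequality for an increasing and a decreasing function
  (\<open>expect_smaller_component\<close>).

  For \<open>rs\<close> and \<open>tx\<close> some configuration of positive probability is left over when
  \<open>0 < p < 1\<close>, so deleting one of these is strictly worse, which gives uniqueness.
\<close>

section \<open>Random subsets of edges\<close>

text \<open>The expectation of \<open>g\<close> at a random subset of \<open>E\<close> that keeps each element independently with
  probability \<open>p\<close>.  A finite sum is more convenient here than a measure, as several identities
  below are polynomial identities in \<open>p\<close>.\<close>
definition expect :: "'e set \<Rightarrow> real \<Rightarrow> ('e set \<Rightarrow> real) \<Rightarrow> real" where
  "expect E p g = (\<Sum>F\<in>Pow E. p ^ card F * (1 - p) ^ card (E - F) * g F)"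

lemma expect_cong: "(\<And>F. F \<subseteq> E \<Longrightarrow> g F = h F) \<Longrightarrow> expect E p g = expect E p h"
  unfolding expect_def by (intro sum.cong) auto

lemma expect_mono:
  assumes "0 \<le> p" "p \<le> 1" "\<And>F. F \<subseteq> E \<Longrightarrow> g F \<le> h F"
  shows "expect E p g \<le> expect E p h"
  unfolding expect_def using assms by (intro sum_mono mult_left_mono) auto

lemma expect_add: "expect E p (\<lambda>F. g F + h F) = expect E p g + expect E p h"
  by (simp add: expect_def sum.distrib algebra_simps)

lemma expect_diff: "expect E p (\<lambda>F. g F - h F) = expect E p g - expect E p h"
  by (simp add: expect_def sum_subtractf algebra_simps)

lemma expect_cmult: "expect E p (\<lambda>F. c * g F) = c * expect E p g"
  by (simp add: expect_def sum_distrib_left algebra_simps)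

lemma expect_sum: "expect E p (\<lambda>F. \<Sum>i\<in>I. g i F) = (\<Sum>i\<in>I. expect E p (g i))"
  unfolding expect_def by (subst sum.swap) (simp add: sum_distrib_left)

lemma expect_nonneg:
  assumes "0 \<le> p" "p \<le> 1" "\<And>F. F \<subseteq> E \<Longrightarrow> 0 \<le> g F"
  shows "0 \<le> expect E p g"
  unfolding expect_def using assms by (intro sum_nonneg mult_nonneg_nonneg) auto

lemma expect_pos:
  assumes "finite E" "0 < p" "p < 1" "\<And>F. F \<subseteq> E \<Longrightarrow> 0 \<le> g F" "F0 \<subseteq> E" "0 < g F0"
  shows "0 < expect E p g"
  unfolding expect_def
  using assms by (intro sum_pos2[of _ F0]) auto

lemma expect_1:
  assumes "finite E"
  shows "expect E 1 g = g E"
proof -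
  have "expect E 1 g = (\<Sum>F\<in>Pow E. if F = E then g F else 0)"
    unfolding expect_def using assms
    by (intro sum.cong) (auto simp: card_gt_0_iff zero_power)
  then show ?thesis using assms by simp
qed

text \<open>Independence: the parts of the random set in disjoint ground sets can be chosen one after the
  other.\<close>
lemma expect_Un:
  assumes "finite A" "finite B" "A \<inter> B = {}"
  shows "expect (A \<union> B) p g = expect A p (\<lambda>X. expect B p (\<lambda>Y. g (X \<union> Y)))"
proof -
  have "expect (A \<union> B) p g = (\<Sum>(X, Y)\<in>Pow A \<times> Pow B.
      p ^ card X * (1 - p) ^ card (A - X) * (p ^ card Y * (1 - p) ^ card (B - Y) * g (X \<union> Y)))"
    unfolding expect_def
  proof (rule sum.reindex_bij_witness[where i = "\<lambda>(X, Y). X \<union> Y" and j = "\<lambda>F. (F \<inter> A, F \<inter> B)"],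
      goal_cases)
    case (5 F)
    then have F: "F = (F \<inter> A) \<union> (F \<inter> B)" "finite F"
      using assms by (auto intro: finite_subset)
    have "card F = card (F \<inter> A) + card (F \<inter> B)"
      using assms F by (metis card_Un_disjoint finite_Int inf_bot_right inf_left_commute inf_assoc)
    moreover have "card (A \<union> B - F) = card (A - F \<inter> A) + card (B - F \<inter> B)"
    proof -
      have "A \<union> B - F = (A - F \<inter> A) \<union> (B - F \<inter> B)" by auto
      then show ?thesis using assms by (simp only:, intro card_Un_disjoint) auto
    qed
    ultimately show ?case using F(1) by (simp add: power_add algebra_simps)
  qed (use assms in auto)
  also have "\<dots> = expect A p (\<lambda>X. expect B p (\<lambda>Y. g (X \<union> Y)))"
    unfolding expect_def by (simp add: sum.cartesian_product sum_distrib_left)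
  finally show ?thesis .
qed

lemma expect_image:
  assumes "inj_on h E"
  shows "expect (h ` E) p g = expect E p (\<lambda>F. g (h ` F))"
proof -
  have "expect (h ` E) p g
      = (\<Sum>F\<in>Pow E. p ^ card (h ` F) * (1 - p) ^ card (h ` E - h ` F) * g (h ` F))"
    unfolding expect_def
    by (rule sum.reindex_bij_betw[symmetric], rule bij_betw_Pow) (use assms in \<open>simp add: bij_betw_def\<close>)
  also have "\<dots> = expect E p (\<lambda>F. g (h ` F))"
    unfolding expect_def
  proof (rule sum.cong[OF refl])
    fix F assume "F \<in> Pow E"
    then have "inj_on h F" "h ` E - h ` F = h ` (E - F)" "inj_on h (E - F)"
      using assms by (auto intro: inj_on_subset dest: inj_onD)
    then show "p ^ card (h ` F) * (1 - p) ^ card (h ` E - h ` F) * g (h ` F) =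
        p ^ card F * (1 - p) ^ card (E - F) * g (h ` F)"
      by (simp add: card_image)
  qed
  finally show ?thesis .
qed

lemma expect_empty: "expect {} p g = g {}"
  by (simp add: expect_def)

lemma expect_insert:
  assumes "finite E" "e \<notin> E"
  shows "expect (insert e E) p g = p * expect E p (\<lambda>F. g (insert e F)) + (1 - p) * expect E p g"
proof -
  have "expect (insert e E) p g = expect E p (\<lambda>X. p * g (insert e X) + (1 - p) * g X)"
    using expect_Un[of E "{e}" p g] assms
    by (simp add: expect_def[of "{e}"] Pow_insert algebra_simps)
  then show ?thesis by (simp add: expect_add expect_cmult)
qed

lemma expect_const:
  assumes "finite E"
  shows "expect E p (\<lambda>_. c) = c"
  using assms by induction (simp_all add: expect_empty expect_insert algebra_simps)

lemma expect_avoid: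
  assumes "finite E" "B \<subseteq> E"
  shows "expect E p (\<lambda>F. of_bool (F \<inter> B = {})) = (1 - p) ^ card B"
proof -
  have fin: "finite B" "finite (E - B)" using assms finite_subset by auto
  have "expect E p (\<lambda>F. of_bool (F \<inter> B = {})) = expect (B \<union> (E - B)) p (\<lambda>F. of_bool (F \<inter> B = {}))"
    using assms by (simp add: Un_absorb1)
  also have "\<dots> = expect B p (\<lambda>X. expect (E - B) p (\<lambda>Y. of_bool ((X \<union> Y) \<inter> B = {})))"
    using fin by (intro expect_Un) auto
  also have "\<dots> = expect B p (\<lambda>X. expect (E - B) p (\<lambda>Y. of_bool (X = {})))"
    by (intro expect_cong arg_cong[where f = of_bool]) auto
  also have "\<dots> = (\<Sum>F\<in>Pow B. if F = {} then (1 - p) ^ card B else 0)"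
    unfolding expect_const[OF fin(2)] by (auto simp: expect_def intro: sum.cong)
  also have "\<dots> = (1 - p) ^ card B" using fin by simp
  finally show ?thesis .
qed

text \<open>Keeping \<open>e\<close> or not is independent of the rest, so deleting \<open>e\<close> from the ground set costs \<open>p\<close>
  times the mean of the increment at \<open>e\<close> over subsets of \<open>E - {e}\<close>.  The factor \<open>1 - p\<close> turns that into
  a mean over subsets of \<open>E\<close>: the increment vanishes when \<open>e\<close> is present, and \<open>e\<close> is absent with
  probability \<open>1 - p\<close>.  Now different \<open>e\<close> can be compared on the same probability space.\<close>
lemma expect_delete:
  assumes "finite E" "e \<in> E"
  shows "(1 - p) * (expect E p g - expect (E - {e}) p g)
    = p * expect E p (\<lambda>F. g (insert e F) - g F)"
proof -
  define E' where "E' = E - {e}"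
  have E: "E = insert e E'" "finite E'" "e \<notin> E'" using assms by (auto simp: E'_def)
  have "E' = E - {e}" using E by auto
  show ?thesis unfolding \<open>E' = E - {e}\<close>[symmetric] unfolding E(1)
    using E(2,3) by (simp add: expect_insert expect_diff algebra_simps)
qed

lemma expect_delete_difference:
  assumes "finite E" "e \<in> E" "f \<in> E"
  shows "(1 - p) * (expect (E - {f}) p g - expect (E - {e}) p g)
    = p * (expect E p (\<lambda>F. g (insert e F) - g F) - expect E p (\<lambda>F. g (insert f F) - g F))"
  using expect_delete[OF assms(1,2), of p g] expect_delete[OF assms(1,3), of p g]
  by (simp add: algebra_simps)

text \<open>Cancels the factor \<open>1 - p\<close> of the previous identity; \<open>k\<close> is a surplus that makes the comparison
  strict.\<close>
lemma less_if_difference_scaled: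
  fixes p :: real
  assumes p: "0 \<le> p" "p < 1" and eq: "(1 - p) * (a - b) = p * (c - d)" and le: "d + k \<le> c" "0 \<le> k"
  shows "b \<le> a" and "0 < p \<Longrightarrow> 0 < k \<Longrightarrow> b < a"
proof -
  have "0 \<le> (1 - p) * (a - b)" unfolding eq using p le by simp
  then show "b \<le> a" using p by (simp add: zero_le_mult_iff)
  assume "0 < p" "0 < k"
  then have "0 < (1 - p) * (a - b)" unfolding eq using le by simp
  then show "b < a" using p by (simp add: zero_less_mult_iff)
qed

section \<open>Connected components of edge sets\<close>

definition component :: "'a set set \<Rightarrow> 'a \<Rightarrow> 'a set" where
  "component F u = {v. connected_using F u v}"

lemma connected_using_refl [simp]: "connected_using F u u"
  by (simp add: connected_using_def)

lemma connected_using_trans: "connected_using F u v \<Longrightarrow> connected_using F v w \<Longrightarrow> connected_using F u w"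
  unfolding connected_using_def by (rule rtrancl_trans)

lemma connected_using_sym: "connected_using F u v \<Longrightarrow> connected_using F v u"
  unfolding connected_using_def
  by (rule symD[OF sym_rtrancl]) (auto simp: sym_def insert_commute)

lemma connected_using_edge: "{u, v} \<in> F \<Longrightarrow> connected_using F u v"
  unfolding connected_using_def by auto

lemma connected_using_mono: "F \<subseteq> F' \<Longrightarrow> connected_using F u v \<Longrightarrow> connected_using F' u v"
  unfolding connected_using_def by (erule rtrancl_mono[THEN subsetD, rotated]) auto

lemma component_eq_iff: "component F u = component F v \<longleftrightarrow> connected_using F u v"
  unfolding component_def
  by (auto intro: connected_using_trans connected_using_sym)

lemma self_in_component [simp]: "u \<in> component F u"
  by (simp add: component_def)

lemma mem_component_iff: "v \<in> component F u \<longleftrightarrow> component F v = component F u"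
  by (auto simp: component_eq_iff) (auto simp: component_def intro: connected_using_sym)

text \<open>The way to bound a component from above: no edge leaves the set \<open>A\<close>.\<close>
lemma component_subset_closed:
  assumes "u \<in> A" "\<And>e. e \<in> F \<Longrightarrow> e \<subseteq> A \<or> e \<inter> A = {}"
  shows "component F u \<subseteq> A"
proof
  fix v assume "v \<in> component F u"
  then have "(u, v) \<in> {(x, y). {x, y} \<in> F}\<^sup>*" by (simp add: component_def connected_using_def)
  then show "v \<in> A"
  proof induction
    case (step y z)
    then show ?case using assms(2)[of "{y, z}"] by auto
  qed (use assms in simp)
qed

lemma connected_using_insert:
  "connected_using (insert {x, y} F) u v \<longleftrightarrow>
    component F u = component F v \<or>
    component F u = component F x \<and> component F y = component F v \<or>
    component F u = component F y \<and> component F x = component F v"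
  (is "?L \<longleftrightarrow> ?R")
proof
  assume ?R
  have 1: "connected_using (insert {x, y} F) u v" if "component F u = component F v" for u v
    using that connected_using_mono[of F "insert {x, y} F" u v] by (auto simp: component_eq_iff)
  have 2: "connected_using (insert {x, y} F) x y" "connected_using (insert {x, y} F) y x"
    by (auto intro!: connected_using_edge simp: insert_commute)
  from \<open>?R\<close> show ?L
    using 1[of u v] connected_using_trans[OF connected_using_trans[OF 1[of u x] 2(1)] 1[of y v]]
      connected_using_trans[OF connected_using_trans[OF 1[of u y] 2(2)] 1[of x v]] by blast
next
  assume ?L
  then have "(u, v) \<in> {(a, b). {a, b} \<in> insert {x, y} F}\<^sup>*" by (simp add: connected_using_def)
  then show ?R
  proof induction
    case (step v w)
    then have "{v, w} = {x, y} \<or> component F v = component F w"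
      by (auto simp: component_eq_iff intro: connected_using_edge)
    then show ?case using step.IH by (auto simp: doubleton_eq_iff)
  qed simp
qed

text \<open>Equality of component labels after the components labelled \<open>x\<close> and \<open>y\<close> have been merged.  It speaks of
  labels alone, so questions about adding an edge become questions about equations.\<close>
definition glued :: "'k \<Rightarrow> 'k \<Rightarrow> 'k \<Rightarrow> 'k \<Rightarrow> bool" where
  "glued x y u v \<longleftrightarrow> u = v \<or> u = x \<and> y = v \<or> u = y \<and> x = v"

lemma component_insert_eq_iff:
  "component (insert {x, y} F) u = component (insert {x, y} F) v \<longleftrightarrow>
    glued (component F x) (component F y) (component F u) (component F v)"
  by (simp add: component_eq_iff[of "insert {x, y} F"] connected_using_insert glued_def)

lemma connected_using_image:
  "connected_using F u v \<Longrightarrow> connected_using ((`) f ` F) (f u) (f v)"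
  unfolding connected_using_def
proof (induction rule: rtrancl_induct)
  case (step v w)
  then have "f ` {v, w} \<in> (`) f ` F" by blast
  then have "(f v, f w) \<in> {(x, y). {x, y} \<in> (`) f ` F}" by simp
  with step.IH show ?case by (rule rtrancl_into_rtrancl)
qed simp

text \<open>The nontrivial direction is the trivial one for the inverse map.\<close>
lemma connected_using_inj_image:
  assumes "inj_on f V" "F \<subseteq> Pow V" "u \<in> V" "v \<in> V"
  shows "connected_using ((`) f ` F) (f u) (f v) \<longleftrightarrow> connected_using F u v"
proof
  assume "connected_using ((`) f ` F) (f u) (f v)"
  from connected_using_image[OF this, of "inv_into V f"]
  have "connected_using ((`) (inv_into V f) ` (`) f ` F) u v"
    using assms by simp
  moreover have "(`) (inv_into V f) ` (`) f ` F = F"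
  proof -
    have "inv_into V f ` f ` e = e" if "e \<in> F" for e
      using assms that by (intro inv_into_image_cancel) auto
    then show ?thesis by (auto simp: image_image)
  qed
  ultimately show "connected_using F u v" by simp
qed (rule connected_using_image)

section \<open>Complete graphs and relabelling of vertices\<close>

definition all_pairs :: "'a set \<Rightarrow> 'a set set" where
  "all_pairs V = {{u, v} | u v. u \<in> V \<and> v \<in> V \<and> u \<noteq> v}"

lemma all_pairs_subset_Pow: "all_pairs V \<subseteq> Pow V"
  by (auto simp: all_pairs_def)

lemma finite_all_pairs: "finite V \<Longrightarrow> finite (all_pairs V)"
  using all_pairs_subset_Pow by (metis finite_Pow_iff finite_subset)

lemma pair_in_all_pairs [simp]: "{u, v} \<in> all_pairs V \<longleftrightarrow> u \<in> V \<and> v \<in> V \<and> u \<noteq> v"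
  by (auto simp: all_pairs_def doubleton_eq_iff)

lemma card_all_pairs:
  assumes "finite V"
  shows "card (all_pairs V) = card V choose 2"
proof -
  have "all_pairs V = {e. e \<subseteq> V \<and> card e = 2}"
    by (auto simp: all_pairs_def card_2_iff)
  then show ?thesis using n_subsets[OF assms] by simp
qed

lemma all_pairs_image:
  assumes "inj_on f V"
  shows "(`) f ` all_pairs V = all_pairs (f ` V)"
proof
  show "(`) f ` all_pairs V \<subseteq> all_pairs (f ` V)"
    using assms by (force simp: all_pairs_def dest: inj_onD)
  show "all_pairs (f ` V) \<subseteq> (`) f ` all_pairs V"
  proof
    fix e assume "e \<in> all_pairs (f ` V)"
    then obtain u v where uv: "u \<in> V" "v \<in> V" "f u \<noteq> f v" "e = f ` {u, v}"
      by (auto simp: all_pairs_def)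
    then have "{u, v} \<in> all_pairs V" by auto
    then show "e \<in> (`) f ` all_pairs V" using uv by blast
  qed
qed

text \<open>The distribution of a random subgraph of a complete graph is invariant under permutations of the
  vertices.  The symmetry arguments between vertices of one graph rest on this.\<close>
lemma expect_relabel:
  assumes "\<pi> permutes V"
  shows "expect (all_pairs V) p g = expect (all_pairs V) p (\<lambda>F. g ((`) \<pi> ` F))"
proof -
  have inj: "inj_on \<pi> V" "inj \<pi>" using assms permutes_inj_on permutes_inj by auto
  have "(`) \<pi> ` all_pairs V = all_pairs V"
    using all_pairs_image[OF inj(1)] permutes_image[OF assms] by simp
  moreover have "inj_on ((`) \<pi>) (all_pairs V)"
    using inj(2) by (simp add: inj_on_def inj_image_eq_iff)
  ultimately show ?thesis using expect_image[of "(`) \<pi>" "all_pairs V" p g] by simp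
qed

lemma component_relabel:
  assumes "bij \<pi>"
  shows "component ((`) \<pi> ` F) (\<pi> u) = \<pi> ` component F u"
proof -
  have "connected_using ((`) \<pi> ` F) (\<pi> u) (\<pi> v) \<longleftrightarrow> connected_using F u v" for v
    using assms connected_using_inj_image[of \<pi> UNIV F u v] by (auto simp: bij_def)
  then show ?thesis unfolding component_def using assms
    by (auto simp: bij_def surj_def image_iff) metis
qed

lemma component_subset_verts:
  assumes "F \<subseteq> all_pairs V" "u \<in> V"
  shows "component F u \<subseteq> V"
  using assms all_pairs_subset_Pow by (intro component_subset_closed) auto

text \<open>One transposition per list entry is enough: it corrects the head and leaves the images of the
  tail alone.\<close>
lemma permutation_mapping_list:
  assumes "length xs = length ys" "distinct xs" "distinct ys" "set xs \<subseteq> V" "set ys \<subseteq> V"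
  obtains \<pi> where "\<pi> permutes V" "map \<pi> xs = ys"
  using assms
proof (induction xs ys arbitrary: thesis rule: list_induct2)
  case Nil
  show ?case by (rule Nil.prems(1)[OF permutes_id]) simp
next
  case (Cons x xs y ys)
  then obtain \<pi> where \<pi>: "\<pi> permutes V" "map \<pi> xs = ys" by auto
  let ?\<tau> = "Transposition.transpose (\<pi> x) y"
  have "\<pi> x \<notin> set ys"
    using \<pi> Cons.prems permutes_inj[OF \<pi>(1)] by (auto dest: injD)
  then have "map ?\<tau> ys = ys"
    using Cons.prems by (intro map_idI) (metis distinct.simps(2) transpose_apply_other)
  moreover have "?\<tau> permutes V"
    using Cons.prems permutes_in_image[OF \<pi>(1)] by (intro permutes_swap_id) auto
  ultimately show ?case
    using \<pi> by (intro Cons.prems(1)[OF permutes_compose[OF \<pi>(1)]]) auto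
qed

section \<open>The component with three marked vertices tends to be larger\<close>

definition ordered_pairs :: "'a set \<Rightarrow> ('a \<times> 'a) set" where
  "ordered_pairs A = (SIGMA x:A. A - {x})"

lemma card_ordered_pairs:
  assumes "finite A"
  shows "card (ordered_pairs A) = card A * (card A - 1)"
  using assms by (simp add: ordered_pairs_def card_SigmaI card_Diff_singleton)

text \<open>In both means the event is that \<open>b\<close> and \<open>c\<close> are with \<open>a\<close> but \<open>s\<close> is not, which favours large
  components of \<open>a\<close>, and \<open>q ^ n\<close> does not increase with \<open>n\<close>.  The comparison fails for single edge sets and
  is only true on average.  By symmetry \<open>b\<close> and \<open>c\<close> may be replaced by any two other vertices.  Summing over
  these choices leaves \<open>(\<alpha> - 1) (\<alpha> - 2) (q ^ \<sigma> - q ^ \<alpha>)\<close> whenever \<open>a\<close> and \<open>s\<close> are separated, where \<open>\<alpha>\<close> and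
  \<open>\<sigma>\<close> are the sizes of their components; exchanging \<open>a\<close> and \<open>s\<close> and adding, the integrand becomes
  a product of two differences of equal sign.\<close>
lemma expect_smaller_component:
  assumes V: "finite V" "{a, b, c, s} \<subseteq> V" and dist: "distinct [a, b, c, s]"
    and p: "0 \<le> p" "p \<le> 1" and q: "0 \<le> q" "q \<le> 1"
  shows "expect (all_pairs V) p (\<lambda>F. of_bool (component F b = component F a \<and> component F c = component F a
        \<and> component F a \<noteq> component F s) * q ^ card (component F a))
    \<le> expect (all_pairs V) p (\<lambda>F. of_bool (component F b = component F a \<and> component F c = component F a
        \<and> component F a \<noteq> component F s) * q ^ card (component F s))"
proof -
  define gain where "gain a s x y F = of_bool (component F x = component F a \<and> component F y = component F a
      \<and> component F a \<noteq> component F s) * (q ^ card (component F s) - q ^ card (component F a))"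
    for a s x y :: 'a and F
  define f where "f n = real ((n - 1) * (n - 1 - 1))" for n :: nat
  define total where "total a s F = of_bool (component F a \<noteq> component F s) * f (card (component F a)) *
      (q ^ card (component F s) - q ^ card (component F a))" for a s :: 'a and F
  let ?E = "expect (all_pairs V) p"
  let ?D = "ordered_pairs (V - {a, s})"
  have gain_relabel: "gain (\<pi> a) (\<pi> s) (\<pi> x) (\<pi> y) ((`) \<pi> ` F) = gain a s x y F"
    "total (\<pi> a) (\<pi> s) ((`) \<pi> ` F) = total a s F" if "bij \<pi>" for \<pi> a s x y F
  proof -
    have "inj \<pi>" using that by (simp add: bij_def)
    then have "card (\<pi> ` component F u) = card (component F u)" for u
      using card_image inj_on_subset by blast
    then show "gain (\<pi> a) (\<pi> s) (\<pi> x) (\<pi> y) ((`) \<pi> ` F) = gain a s x y F"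
      "total (\<pi> a) (\<pi> s) ((`) \<pi> ` F) = total a s F"
      using \<open>inj \<pi>\<close> unfolding gain_def total_def component_relabel[OF that]
      by (simp_all add: inj_image_eq_iff)
  qed
  have same: "?E (gain a s x y) = ?E (gain a s b c)" if xy: "(x, y) \<in> ?D" for x y
  proof -
    obtain \<pi> where \<pi>: "\<pi> permutes V" "\<pi> a = a" "\<pi> s = s" "\<pi> b = x" "\<pi> c = y"
      by (rule permutation_mapping_list[of "[a, s, b, c]" "[a, s, x, y]" V])
        (use xy V dist in \<open>auto simp: ordered_pairs_def\<close>)
    have "?E (gain a s x y) = ?E (\<lambda>F. gain a s x y ((`) \<pi> ` F))"
      by (rule expect_relabel[OF \<pi>(1)])
    also have "\<dots> = ?E (gain a s b c)"
      using gain_relabel(1)[of \<pi> a s b c] permutes_bij[OF \<pi>(1)] \<pi> by simp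
    finally show ?thesis .
  qed
  \<comment> \<open>The companions of \<open>a\<close> are counted: both lie in its component, which has \<open>\<alpha> - 1\<close> other
    vertices and does not contain \<open>s\<close>.\<close>
  have total: "(\<Sum>(x, y)\<in>?D. gain a s x y F) = total a s F" if F: "F \<subseteq> all_pairs V" for F
  proof (cases "component F a = component F s")
    case False
    let ?A = "component F a - {a}"
    have sub: "component F a \<subseteq> V" using component_subset_verts[OF F, of a] V by simp
    then have fin: "finite (component F a)" using V(1) by (rule finite_subset)
    have mem: "component F x = component F a \<longleftrightarrow> x \<in> component F a" for x
      by (simp add: mem_component_iff)
    have "s \<notin> component F a" using False mem[of s] by auto
    then have D: "{z \<in> ?D. component F (fst z) = component F a \<and> component F (snd z) = component F a}
        = ordered_pairs ?A"
      using sub by (auto simp: ordered_pairs_def mem)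
    have "finite ?D" using V(1) by (simp add: ordered_pairs_def)
    have "(\<Sum>(x, y)\<in>?D. gain a s x y F) = (\<Sum>z\<in>?D.
        if component F (fst z) = component F a \<and> component F (snd z) = component F a
        then q ^ card (component F s) - q ^ card (component F a) else 0)"
      using False by (simp add: gain_def of_bool_def case_prod_unfold if_distribR
          if_distrib[where f = "\<lambda>k. k * _"] cong: if_cong)
    also have "\<dots> = (\<Sum>z\<in>{z \<in> ?D. component F (fst z) = component F a \<and> component F (snd z) = component F a}.
        q ^ card (component F s) - q ^ card (component F a))"
      by (rule sum.inter_filter[OF \<open>finite ?D\<close>, symmetric])
    also have "\<dots> = card (ordered_pairs ?A) * (q ^ card (component F s) - q ^ card (component F a))"
      unfolding D by simp
    also have "\<dots> = total a s F"
      using False fin by (simp add: total_def f_def card_ordered_pairs)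
    finally show ?thesis .
  qed (simp add: gain_def total_def)
  have 1: "real (card ?D) * ?E (gain a s b c) = ?E (total a s)"
  proof -
    have "real (card ?D) * ?E (gain a s b c) = (\<Sum>(x, y)\<in>?D. ?E (gain a s x y))"
      using same by (simp add: case_prod_unfold)
    also have "\<dots> = ?E (\<lambda>F. \<Sum>(x, y)\<in>?D. gain a s x y F)"
      by (simp add: expect_sum case_prod_unfold)
    also have "\<dots> = ?E (total a s)" by (rule expect_cong) (rule total)
    finally show ?thesis .
  qed
  have 2: "?E (total a s) = ?E (total s a)"
  proof -
    have "Transposition.transpose a s permutes V" using V by (intro permutes_swap_id) auto
    from expect_relabel[OF this, of p "total a s"] show ?thesis
      using gain_relabel(2)[of "Transposition.transpose a s" s a] by simp
  qed
  have "0 \<le> ?E (\<lambda>F. total a s F + total s a F)"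
  proof -
    have "0 \<le> total a s F + total s a F" for F
    proof -
      let ?\<alpha> = "card (component F a)" and ?\<sigma> = "card (component F s)"
      have mono: "f m \<le> f n \<and> q ^ n \<le> q ^ m" if "m \<le> n" for m n
        using that q unfolding f_def by (auto intro!: mult_mono power_decreasing)
      \<comment> \<open>Both factors are nonnegative if \<open>\<sigma> \<le> \<alpha>\<close>, and neither is positive otherwise.\<close>
      have "0 \<le> (f ?\<alpha> - f ?\<sigma>) * (q ^ ?\<sigma> - q ^ ?\<alpha>)"
        using mono[of ?\<alpha> ?\<sigma>] mono[of ?\<sigma> ?\<alpha>] by (cases ?\<alpha> ?\<sigma> rule: le_cases) (auto simp: zero_le_mult_iff)
      then show ?thesis by (auto simp: total_def algebra_simps)
    qed
    then show ?thesis by (intro expect_nonneg p)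
  qed
  then have "0 \<le> real (card ?D) * ?E (gain a s b c)" using 1 2 by (simp add: expect_add)
  moreover have "0 < card ?D"
  proof -
    have "(b, c) \<in> ?D" "finite ?D" using V dist by (auto simp: ordered_pairs_def)
    then show ?thesis by (auto simp: card_gt_0_iff)
  qed
  ultimately have "0 \<le> ?E (gain a s b c)" by (simp add: zero_le_mult_iff)
  then show ?thesis unfolding gain_def by (simp add: right_diff_distrib expect_diff)
qed

section \<open>Removing one vertex\<close>

definition split_3_2 :: "'a set set \<Rightarrow> 'a \<Rightarrow> 'a \<Rightarrow> 'a \<Rightarrow> 'a \<Rightarrow> 'a \<Rightarrow> bool" where
  "split_3_2 F a b c d e \<longleftrightarrow> component F a = component F b \<and> component F b = component F c \<and>
     component F d = component F e \<and> component F a \<noteq> component F d"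

definition star :: "'a \<Rightarrow> 'a set \<Rightarrow> 'a set set" where
  "star w N = (\<lambda>v. {w, v}) ` N"

text \<open>Revealing the edges at \<open>w\<close> last: its set of neighbours is a random subset of the remaining
  vertices, independent of the graph on these.\<close>
lemma expect_star:
  assumes "finite V" "w \<notin> V"
  shows "expect (all_pairs (insert w V)) p g
    = expect (all_pairs V) p (\<lambda>F. expect V p (\<lambda>N. g (F \<union> star w N)))"
proof -
  have "all_pairs (insert w V) = all_pairs V \<union> star w V"
    using assms(2) by (auto simp: all_pairs_def star_def)
  moreover have "all_pairs V \<inter> star w V = {}"
    using assms(2) all_pairs_subset_Pow[of V] by (auto simp: star_def)
  moreover have "inj_on (\<lambda>v. {w, v}) V" by (auto simp: inj_on_def doubleton_eq_iff)
  then have "expect (star w V) p g' = expect V p (\<lambda>N. g' (star w N))" for g'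
    unfolding star_def by (rule expect_image)
  ultimately show ?thesis
    using assms(1) expect_Un[of "all_pairs V" "star w V" p g] finite_all_pairs[of V]
    by (simp add: star_def)
qed

lemma component_star:
  assumes "F \<subseteq> all_pairs V" "w \<notin> V" "u \<in> V" "N \<inter> component F u = {}"
  shows "component (F \<union> star w N) u = component F u"
proof
  show "component F u \<subseteq> component (F \<union> star w N) u"
    using connected_using_mono[of F "F \<union> star w N"] by (auto simp: component_def)
  show "component (F \<union> star w N) u \<subseteq> component F u"
  proof (rule component_subset_closed)
    fix e assume e: "e \<in> F \<union> star w N"
    show "e \<subseteq> component F u \<or> e \<inter> component F u = {}"
    proof (cases "e \<in> F")
      case True
      then obtain x y where "e = {x, y}" using assms(1) by (auto simp: all_pairs_def)
      with True have "component F x = component F y"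
        by (auto simp: component_eq_iff intro: connected_using_edge)
      then show ?thesis using \<open>e = {x, y}\<close>
        by (auto simp: mem_component_iff)
    next
      case False
      then obtain v where "v \<in> N" "e = {w, v}" using e by (auto simp: star_def)
      then show ?thesis using assms component_subset_verts[OF assms(1,3)] by auto
    qed
  qed simp
qed

text \<open>Given that \<open>a, b, c\<close> are together and \<open>s\<close> is elsewhere, \<open>w\<close> is no likelier to be with \<open>s\<close> than not
  to be.  Both events are compared with events that depend on \<open>F\<close>, the graph without \<open>w\<close>, and on whether the
  neighbours \<open>N\<close> of \<open>w\<close> avoid a component of \<open>F\<close>: in the first they avoid the component of \<open>a\<close>, and for the
  second it is sufficient to avoid that of \<open>s\<close>.  The two avoidance probabilities are then compared
  by \<open>expect_smaller_component\<close>.\<close>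
lemma expect_split_3_2_le:
  assumes V: "finite V" "{a, b, c, s, w} \<subseteq> V" and dist: "distinct [a, b, c, s, w]"
    and p: "0 \<le> p" "p \<le> 1"
  shows "expect (all_pairs V) p (\<lambda>F. of_bool (split_3_2 F a b c s w))
    \<le> expect (all_pairs V) p (\<lambda>F. of_bool (component F a = component F b \<and> component F b = component F c
        \<and> component F a \<noteq> component F s \<and> component F w \<noteq> component F s))"
    (is "?L \<le> expect _ _ (\<lambda>F. of_bool (?R F))")
proof -
  define V' where "V' = V - {w}"
  have V': "V = insert w V'" "finite V'" "w \<notin> V'" "{a, b, c, s} \<subseteq> V'"
    using V dist by (auto simp: V'_def)
  let ?E = "expect (all_pairs V') p"
  define Q where "Q F \<longleftrightarrow> component F b = component F a \<and> component F c = component F a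
    \<and> component F a \<noteq> component F s" for F
  have avoid: "expect V' p (\<lambda>N. of_bool (Q F) * of_bool (N \<inter> component F u = {}))
      = of_bool (Q F) * (1 - p) ^ card (component F u)" if "F \<subseteq> all_pairs V'" "u \<in> V'" for F u
    using expect_avoid[OF V'(2) component_subset_verts[OF that]] by (simp add: expect_cmult)
  have mono: "component (F \<union> star w N) u = component (F \<union> star w N) v"
    if "component F u = component F v" for F N u v
    using that connected_using_mono[of F "F \<union> star w N"] by (auto simp: component_eq_iff)
  have "?L = ?E (\<lambda>F. expect V' p (\<lambda>N. of_bool (split_3_2 (F \<union> star w N) a b c s w)))"
    unfolding V'(1) by (rule expect_star[OF V'(2,3)])
  also have "\<dots> \<le> ?E (\<lambda>F. expect V' p (\<lambda>N. of_bool (Q F) * of_bool (N \<inter> component F a = {})))"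
  proof (intro expect_mono p)
    fix F N assume F: "F \<subseteq> all_pairs V'" and N: "N \<subseteq> V'"
    have "Q F \<and> N \<inter> component F a = {}" if split: "split_3_2 (F \<union> star w N) a b c s w"
    proof -
      have "component (F \<union> star w N) v = component (F \<union> star w N) w" if "v \<in> N" for v
        using that by (auto simp: component_eq_iff star_def insert_commute intro!: connected_using_edge)
      moreover have "component (F \<union> star w N) v = component (F \<union> star w N) a" if "v \<in> component F a" for v
        using that mono[of F a v N] by (simp add: mem_component_iff)
      ultimately have avoid: "N \<inter> component F a = {}"
        using split unfolding split_3_2_def by fastforce
      then have "component (F \<union> star w N) a = component F a"
        using component_star[OF F V'(3)] V'(4) by simp
      then have "component F b = component F a \<and> component F c = component F a"
        using split unfolding split_3_2_def
        by (metis mem_component_iff)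
      moreover have "component F a \<noteq> component F s"
        using split mono unfolding split_3_2_def by blast
      ultimately show ?thesis using avoid by (simp add: Q_def)
    qed
    then show "of_bool (split_3_2 (F \<union> star w N) a b c s w)
        \<le> (of_bool (Q F) * of_bool (N \<inter> component F a = {}) :: real)" by auto
  qed
  also have "\<dots> = ?E (\<lambda>F. of_bool (Q F) * (1 - p) ^ card (component F a))"
    using avoid V'(4) by (intro expect_cong) simp
  also have "\<dots> \<le> ?E (\<lambda>F. of_bool (Q F) * (1 - p) ^ card (component F s))"
    unfolding Q_def using V' dist p by (intro expect_smaller_component) auto
  also have "\<dots> = ?E (\<lambda>F. expect V' p (\<lambda>N. of_bool (Q F) * of_bool (N \<inter> component F s = {})))"
    using avoid V'(4) by (intro expect_cong) simp
  also have "\<dots> \<le> ?E (\<lambda>F. expect V' p (\<lambda>N. of_bool (?R (F \<union> star w N))))"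
  proof (intro expect_mono p)
    fix F N assume F: "F \<subseteq> all_pairs V'" and N: "N \<subseteq> V'"
    have "?R (F \<union> star w N)" if "Q F" "N \<inter> component F s = {}"
    proof -
      have s: "component (F \<union> star w N) s = component F s"
        using component_star[OF F V'(3)] V'(4) that by simp
      have "w \<notin> component F s" using component_subset_verts[OF F] V' by auto
      moreover have "a \<notin> component F s"
        using that unfolding Q_def by (simp add: mem_component_iff)
      ultimately show ?thesis
        using that mono[of F b a N] mono[of F c a N] self_in_component[of a "F \<union> star w N"]
          self_in_component[of w "F \<union> star w N"]
        unfolding Q_def s[symmetric] by metis
    qed
    then show "of_bool (Q F) * of_bool (N \<inter> component F s = {}) \<le> (of_bool (?R (F \<union> star w N)) :: real)"
      by auto
  qed
  also have "\<dots> = expect (all_pairs V) p (\<lambda>F. of_bool (?R F))"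
    unfolding V'(1) by (rule expect_star[OF V'(2,3), symmetric])
  finally show ?thesis .
qed

section \<open>Which pairs are pivotal\<close>

definition split_prob :: "'a set \<Rightarrow> real \<Rightarrow> 'a \<Rightarrow> 'a \<Rightarrow> 'a \<Rightarrow> 'a \<Rightarrow> 'a \<Rightarrow> real" where
  "split_prob V p a b c d e = expect (all_pairs V) p (\<lambda>F. of_bool (split_3_2 F a b c d e))"

lemma split_prob_eq:
  assumes "{a, b, c, d, e} \<subseteq> V" "distinct [a, b, c, d, e]"
    and "{a', b', c', d', e'} \<subseteq> V" "distinct [a', b', c', d', e']"
  shows "split_prob V p a b c d e = split_prob V p a' b' c' d' e'"
proof -
  obtain \<pi> where \<pi>: "\<pi> permutes V" "map \<pi> [a, b, c, d, e] = [a', b', c', d', e']"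
    using permutation_mapping_list[of "[a, b, c, d, e]" "[a', b', c', d', e']" V] assms by auto
  have "split_3_2 ((`) \<pi> ` F) (\<pi> a) (\<pi> b) (\<pi> c) (\<pi> d) (\<pi> e) \<longleftrightarrow> split_3_2 F a b c d e" for F
    unfolding split_3_2_def component_relabel[OF permutes_bij[OF \<pi>(1)]]
    by (simp add: inj_image_eq_iff[OF permutes_inj[OF \<pi>(1)]])
  then show ?thesis
    using expect_relabel[OF \<pi>(1), of p "\<lambda>F. of_bool (split_3_2 F a' b' c' d' e')"] \<pi>(2)
    unfolding split_prob_def by simp
qed

definition joined3 :: "'a set set \<Rightarrow> 'a \<Rightarrow> 'a \<Rightarrow> 'a \<Rightarrow> bool" where
  "joined3 F r s t \<longleftrightarrow> component F r = component F s \<and> component F s = component F t"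

text \<open>The next three lemmas are about five labels, which stand for the components of the targets
  \<open>r, s, t\<close> and of two further vertices \<open>x, y\<close>.  On the pivotal side, the targets do not all have the same
  label, but do so once the two labels at the pair are merged.  The first lemma holds because the events on
  the right cover this; the other two hold because the events there are disjoint and each of them
  implies it.\<close>
lemma pivotal_nontarget_pair_upper:
  fixes r s t x y :: 'k
  shows "of_bool (\<not> (r = s \<and> s = t) \<and> glued x y r s \<and> glued x y s t)
   \<le> (of_bool (r = s \<and> s = x \<and> t = y \<and> r \<noteq> t) + of_bool (r = s \<and> s = y \<and> t = x \<and> r \<noteq> t)
    + of_bool (r = t \<and> t = x \<and> s = y \<and> r \<noteq> s) + of_bool (r = t \<and> t = y \<and> s = x \<and> r \<noteq> s)
    + of_bool (s = t \<and> t = x \<and> r = y \<and> s \<noteq> r) + of_bool (s = t \<and> t = y \<and> r = x \<and> s \<noteq> r) :: real)"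
proof (cases "r = s")
  case True
  then show ?thesis unfolding glued_def by (cases "s = t"; cases "s = x"; cases "s = y"; auto)
next
  case False
  then show ?thesis unfolding glued_def
    by (cases "r = t"; cases "s = t"; cases "r = x"; cases "r = y"; cases "s = x"; cases "s = y"; simp)
qed

lemma pivotal_mixed_pair_lower:
  fixes r s t x y :: 'k
  shows "of_bool (\<not> (r = s \<and> s = t) \<and> glued t x r s \<and> glued t x s t)
   \<ge> (of_bool (r = s \<and> s = x \<and> r \<noteq> t \<and> y \<noteq> t) + of_bool (r = s \<and> s = x \<and> t = y \<and> r \<noteq> t)
    + of_bool (t = r \<and> r = y \<and> x = s \<and> t \<noteq> x) + of_bool (x = s \<and> s = y \<and> t = r \<and> x \<noteq> t)
    + of_bool (t = s \<and> s = y \<and> x = r \<and> t \<noteq> x) + of_bool (x = r \<and> r = y \<and> t = s \<and> x \<noteq> t)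
    + of_bool (t = r \<and> x = s \<and> t \<noteq> x \<and> y \<noteq> t \<and> y \<noteq> x) :: real)"
proof (cases "r = s")
  case True
  then show ?thesis unfolding glued_def by (cases "s = t"; cases "s = x"; cases "y = t"; auto)
next
  case False
  then show ?thesis unfolding glued_def
    by (cases "r = t"; cases "r = x"; cases "s = t"; cases "s = x"; cases "y = t"; cases "y = x"; simp)
qed

lemma pivotal_target_pair_lower:
  fixes r s t x y :: 'k
  shows "of_bool (\<not> (r = s \<and> s = t) \<and> glued r s r s \<and> glued r s s t)
   \<ge> (of_bool (r = t \<and> t = x \<and> s = y \<and> r \<noteq> s) + of_bool (r = t \<and> t = y \<and> s = x \<and> r \<noteq> s)
    + of_bool (s = x \<and> x = y \<and> r = t \<and> s \<noteq> r)
    + of_bool (s = t \<and> t = x \<and> r = y \<and> s \<noteq> r) + of_bool (s = t \<and> t = y \<and> r = x \<and> s \<noteq> r)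
    + of_bool (r = x \<and> x = y \<and> s = t \<and> r \<noteq> s)
    + of_bool (r = t \<and> s \<noteq> r \<and> x \<noteq> r \<and> x \<noteq> s \<and> y \<noteq> r \<and> y \<noteq> s) :: real)"
  unfolding glued_def
  by (cases "r = s"; cases "s = t"; cases "r = t"; cases "r = x"; cases "r = y";
      cases "s = x"; cases "s = y"; cases "t = x"; cases "t = y"; simp)

text \<open>The last summand in the second and third bounds is there only for strictness: it has positive
  probability, and nothing in the upper bound corresponds to it.\<close>
lemma pivotal_split_bounds:
  fixes r s t x y :: 'a and F :: "'a set set"
  defines "P \<equiv> (\<lambda>u v. of_bool (joined3 (insert {u, v} F) r s t) - of_bool (joined3 F r s t) :: real)"
  shows "P x y \<le>
      of_bool (split_3_2 F r s x t y) + of_bool (split_3_2 F r s y t x)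
    + of_bool (split_3_2 F r t x s y) + of_bool (split_3_2 F r t y s x)
    + of_bool (split_3_2 F s t x r y) + of_bool (split_3_2 F s t y r x)" (is "?A")
  and "P t x \<ge>
      of_bool (component F r = component F s \<and> component F s = component F x
        \<and> component F r \<noteq> component F t \<and> component F y \<noteq> component F t)
    + of_bool (split_3_2 F r s x t y)
    + of_bool (split_3_2 F t r y x s) + of_bool (split_3_2 F x s y t r)
    + of_bool (split_3_2 F t s y x r) + of_bool (split_3_2 F x r y t s)
    + of_bool (component F t = component F r \<and> component F x = component F s
        \<and> component F t \<noteq> component F x \<and> component F y \<noteq> component F t \<and> component F y \<noteq> component F x)"
      (is "?B")
  and "P r s \<ge>
      of_bool (split_3_2 F r t x s y) + of_bool (split_3_2 F r t y s x) + of_bool (split_3_2 F s x y r t)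
    + of_bool (split_3_2 F s t x r y) + of_bool (split_3_2 F s t y r x) + of_bool (split_3_2 F r x y s t)
    + of_bool (component F r = component F t \<and> component F s \<noteq> component F r
        \<and> component F x \<noteq> component F r \<and> component F x \<noteq> component F s
        \<and> component F y \<noteq> component F r \<and> component F y \<noteq> component F s)" (is "?C")
proof -
  have 1: "P u v = of_bool (\<not> joined3 F r s t \<and> joined3 (insert {u, v} F) r s t)" for u v
    unfolding P_def by (auto simp: joined3_def component_insert_eq_iff glued_def)
  show ?A ?B ?C unfolding 1 joined3_def component_insert_eq_iff split_3_2_def
    by (rule pivotal_nontarget_pair_upper pivotal_mixed_pair_lower pivotal_target_pair_lower)+
qed

section \<open>Comparing the three kinds of missing pairs\<close>

text \<open>Each of the six splits in the upper bound for \<open>{x, y}\<close> has the same probability, and so have the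
  splits in the lower bounds.  For \<open>{r, s}\<close> there are six of them.  For \<open>{t, x}\<close> there are five, and the
  summand that is not a split, with \<open>y\<close> not in the component of \<open>t\<close>, makes up for the sixth.\<close>
lemma deleting_pair_at_target:
  fixes p :: real
  assumes V: "finite V" "{r, s, t, x, y} \<subseteq> V" and dist: "distinct [r, s, t, x, y]"
    and p: "0 \<le> p" "p < 1"
  defines "rel \<equiv> (\<lambda>e. expect (all_pairs V - {e}) p (\<lambda>F. of_bool (joined3 F r s t)))"
  shows "rel {t, x} \<le> rel {x, y}" "0 < p \<Longrightarrow> rel {t, x} < rel {x, y}"
    and "rel {r, s} \<le> rel {x, y}" "0 < p \<Longrightarrow> rel {r, s} < rel {x, y}"
proof -
  let ?E = "expect (all_pairs V) p"
  define piv where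
    "piv e = ?E (\<lambda>F. of_bool (joined3 (insert e F) r s t) - of_bool (joined3 F r s t))" for e
  define q where "q = split_prob V p r s x t y"
  have p': "p \<le> 1" using p by simp
  have split: "?E (\<lambda>F. of_bool (split_3_2 F a b c d e)) = q"
    if "{a, b, c, d, e} \<subseteq> V" "distinct [a, b, c, d, e]" for a b c d e
  proof -
    have "split_prob V p a b c d e = q"
      unfolding q_def using V dist by (intro split_prob_eq[OF that]) auto
    then show ?thesis by (simp add: split_prob_def)
  qed
  have rel: "(1 - p) * (rel {x, y} - rel e) = p * (piv e - piv {x, y})" if "e \<in> all_pairs V" for e
    unfolding rel_def piv_def using V dist that finite_all_pairs
    by (intro expect_delete_difference) auto
  note pivotal = pivotal_split_bounds[where r = r and s = s and t = t and x = x and y = y]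
  have dist': "distinct [y, x, t, s, r]" using dist by auto
  have upper: "piv {x, y} \<le> 6 * q"
  proof -
    have "piv {x, y} \<le> ?E (\<lambda>F. of_bool (split_3_2 F r s x t y) + of_bool (split_3_2 F r s y t x)
      + of_bool (split_3_2 F r t x s y) + of_bool (split_3_2 F r t y s x)
      + of_bool (split_3_2 F s t x r y) + of_bool (split_3_2 F s t y r x))"
      unfolding piv_def by (intro expect_mono p p' pivotal(1))
    also have "\<dots> = 6 * q"
      using V dist dist' by (simp add: expect_add split)
    finally show ?thesis .
  qed

  define extra where "extra F \<longleftrightarrow> component F t = component F r \<and> component F x = component F s
    \<and> component F t \<noteq> component F x \<and> component F y \<noteq> component F t \<and> component F y \<noteq> component F x" for F
  have "6 * q + ?E (\<lambda>F. of_bool (extra F)) \<le> piv {t, x}"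
  proof -
    have "?E (\<lambda>F. of_bool (component F r = component F s \<and> component F s = component F x
        \<and> component F r \<noteq> component F t \<and> component F y \<noteq> component F t)
      + of_bool (split_3_2 F r s x t y)
      + of_bool (split_3_2 F t r y x s) + of_bool (split_3_2 F x s y t r)
      + of_bool (split_3_2 F t s y x r) + of_bool (split_3_2 F x r y t s)
      + of_bool (extra F)) \<le> piv {t, x}"
      unfolding piv_def extra_def by (intro expect_mono p p' pivotal(2))
    moreover have "q \<le> ?E (\<lambda>F. of_bool (component F r = component F s \<and> component F s = component F x
        \<and> component F r \<noteq> component F t \<and> component F y \<noteq> component F t))"
      using expect_split_3_2_le[OF V(1), of r s x t y p] V(2) dist p p' split[of r s x t y] by auto
    ultimately show ?thesis using V dist dist' by (simp add: expect_add split)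
  qed
  with upper have tx: "piv {x, y} + ?E (\<lambda>F. of_bool (extra F)) \<le> piv {t, x}" by simp
  have nonneg: "0 \<le> ?E (\<lambda>F. of_bool (P F))" for P
    by (intro expect_nonneg p p') simp
  have extra_pos: "0 < ?E (\<lambda>F. of_bool (extra F))" if "0 < p"
  proof (rule expect_pos[where ?F0.0 = "{{t, r}, {x, s}}"])
    let ?F = "{{t, r}, {x, s}}"
    have "component ?F t \<subseteq> {t, r}" "component ?F x \<subseteq> {x, s}" "component ?F y \<subseteq> {y}"
      by (intro component_subset_closed; use dist in auto)+
    then have "x \<notin> component ?F t" "t \<notin> component ?F y" "x \<notin> component ?F y"
      using dist by auto
    moreover have "connected_using ?F t r" "connected_using ?F x s"
      by (auto intro: connected_using_edge)
    ultimately have "extra ?F"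
      unfolding extra_def by (auto simp: mem_component_iff component_eq_iff[symmetric])
    then show "0 < (of_bool (extra ?F) :: real)" by simp
    show "?F \<subseteq> all_pairs V" using V dist by auto
  qed (use V that p finite_all_pairs in auto)
  have "{t, x} \<in> all_pairs V" using V dist by auto
  note tx_less = less_if_difference_scaled[OF p rel[OF this] tx nonneg]
  show "rel {t, x} \<le> rel {x, y}" by (rule tx_less(1))
  show "rel {t, x} < rel {x, y}" if "0 < p" by (rule tx_less(2)[OF that extra_pos[OF that]])

  define extra' where "extra' F \<longleftrightarrow> component F r = component F t \<and> component F s \<noteq> component F r
    \<and> component F x \<noteq> component F r \<and> component F x \<noteq> component F s
    \<and> component F y \<noteq> component F r \<and> component F y \<noteq> component F s" for F
  have "6 * q + ?E (\<lambda>F. of_bool (extra' F)) \<le> piv {r, s}"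
  proof -
    have "?E (\<lambda>F. of_bool (split_3_2 F r t x s y) + of_bool (split_3_2 F r t y s x)
      + of_bool (split_3_2 F s x y r t)
      + of_bool (split_3_2 F s t x r y) + of_bool (split_3_2 F s t y r x)
      + of_bool (split_3_2 F r x y s t)
      + of_bool (extra' F)) \<le> piv {r, s}"
      unfolding piv_def extra'_def by (intro expect_mono p p' pivotal(3))
    then show ?thesis using V dist dist' by (simp add: expect_add split)
  qed
  with upper have rs: "piv {x, y} + ?E (\<lambda>F. of_bool (extra' F)) \<le> piv {r, s}" by simp
  have extra'_pos: "0 < ?E (\<lambda>F. of_bool (extra' F))" if "0 < p"
  proof (rule expect_pos[where ?F0.0 = "{{r, t}}"])
    let ?F = "{{r, t}}"
    have "component ?F r \<subseteq> {r, t}" "component ?F s \<subseteq> {s}"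
      by (intro component_subset_closed; use dist in auto)+
    then have "s \<notin> component ?F r" "x \<notin> component ?F r" "y \<notin> component ?F r"
      "x \<notin> component ?F s" "y \<notin> component ?F s"
      using dist by auto
    moreover have "connected_using ?F r t"
      by (auto intro: connected_using_edge)
    ultimately have "extra' ?F"
      unfolding extra'_def by (auto simp: mem_component_iff component_eq_iff[symmetric])
    then show "0 < (of_bool (extra' ?F) :: real)" by simp
    show "?F \<subseteq> all_pairs V" using V dist by auto
  qed (use V that p finite_all_pairs in auto)
  have "{r, s} \<in> all_pairs V" using V dist by auto
  note rs_less = less_if_difference_scaled[OF p rel[OF this] rs nonneg]
  show "rel {r, s} \<le> rel {x, y}" by (rule rs_less(1))
  show "rel {r, s} < rel {x, y}" if "0 < p" by (rule rs_less(2)[OF that extra'_pos[OF that]])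
qed

section \<open>Graphs with one missing pair\<close>

lemma reliability3_eq_expect:
  assumes "simple_tt_graph G" "p \<in> {0..1}"
  shows "reliability3 G p = expect (edges G) p (\<lambda>F. of_bool (targets_connected G F))"
proof -
  have fin: "finite (edges G)" using assms(1) by (rule finite_edges)
  let ?A = "{F \<in> Pow (edges G). targets_connected G F}"
  have "reliability3 G p = measure_pmf.prob (surviving_edges G p) ?A"
    unfolding reliability3_def
    by (rule measure_pmf.finite_measure_eq_AE) (auto intro!: AE_pmfI simp: surviving_edges_def)
  also have "\<dots> = (\<Sum>F\<in>?A. pmf (surviving_edges G p) F)"
    using fin by (intro measure_measure_pmf_finite) simp
  also have "\<dots> = (\<Sum>F\<in>?A. p ^ card F * (1 - p) ^ card (edges G - F))"
    using fin assms(2) finite_subset[OF _ fin]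
    by (intro sum.cong) (auto simp: pmf_surviving_edges card_Diff_subset)
  also have "\<dots> = expect (edges G) p (\<lambda>F. of_bool (targets_connected G F))"
  proof -
    have "finite (Pow (edges G))" using fin by simp
    then show ?thesis
      unfolding expect_def sum.inter_filter[OF \<open>finite (Pow (edges G))\<close>] by (intro sum.cong) auto
  qed
  finally show ?thesis .
qed

lemma targets_connected_iff_joined3:
  assumes "targets G = {r, s, t}"
  shows "targets_connected G F \<longleftrightarrow> joined3 F r s t"
  unfolding targets_connected_def joined3_def assms component_eq_iff[symmetric] by auto

lemma tt_isomorphic_reliability3_eq:
  assumes "simple_tt_graph G" "simple_tt_graph H" "tt_isomorphic G H" "p \<in> {0..1}"
  shows "reliability3 G p = reliability3 H p"
proof -
  obtain f where f: "bij_betw f (verts G) (verts H)"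
    "\<And>u v. u \<in> verts G \<Longrightarrow> v \<in> verts G \<Longrightarrow> {u, v} \<in> edges G \<longleftrightarrow> {f u, f v} \<in> edges H"
    "f ` targets G = targets H"
    using assms(3) unfolding tt_isomorphic_def by blast
  have inj: "inj_on f (verts G)" and img: "f ` verts G = verts H"
    using f(1) by (auto simp: bij_betw_def)
  have G: "edges G \<subseteq> all_pairs (verts G)" "targets G \<subseteq> verts G"
    and H: "edges H \<subseteq> all_pairs (verts H)"
    using assms(1,2) by (auto simp: simple_tt_graph_def all_pairs_def)
  have edges: "edges H = (`) f ` edges G"
  proof
    show "edges H \<subseteq> (`) f ` edges G"
    proof
      fix e assume "e \<in> edges H"
      moreover from this obtain u v where "u \<in> verts G" "v \<in> verts G" "e = {f u, f v}"
        using H unfolding img[symmetric] all_pairs_def by blast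
      ultimately have "{u, v} \<in> edges G" "e = f ` {u, v}" using f(2) by auto
      then show "e \<in> (`) f ` edges G" by blast
    qed
    show "(`) f ` edges G \<subseteq> edges H"
    proof safe
      fix e assume "e \<in> edges G"
      moreover from this obtain u v where "u \<in> verts G" "v \<in> verts G" "e = {u, v}"
        using G(1) by (auto simp: all_pairs_def)
      ultimately show "f ` e \<in> edges H" using f(2) by auto
    qed
  qed
  have "inj_on ((`) f) (edges G)"
    using inj_on_image_Pow[OF inj] G(1) all_pairs_subset_Pow inj_on_subset by (metis subset_trans)
  moreover have "targets_connected H ((`) f ` F) \<longleftrightarrow> targets_connected G F" if "F \<subseteq> edges G" for F
  proof -
    have "F \<subseteq> Pow (verts G)" using that G(1) all_pairs_subset_Pow by blast
    then have "connected_using ((`) f ` F) (f u) (f v) \<longleftrightarrow> connected_using F u v"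
      if "u \<in> targets G" "v \<in> targets G" for u v
      using connected_using_inj_image[OF inj] that G(2) by blast
    then show ?thesis unfolding targets_connected_def f(3)[symmetric] by auto
  qed
  ultimately have "expect (edges H) p (\<lambda>F. of_bool (targets_connected H F))
      = expect (edges G) p (\<lambda>F. of_bool (targets_connected G F))"
    unfolding edges by (subst expect_image) (auto intro: expect_cong)
  then show ?thesis using assms by (simp add: reliability3_eq_expect)
qed

lemma simple_tt_graph_edges: "simple_tt_graph G \<Longrightarrow> edges G \<subseteq> all_pairs (verts G)"
  by (auto simp: simple_tt_graph_def all_pairs_def)

lemma missing_pair:
  assumes "G \<in> tt_graphs n ((n choose 2) - 1)" "2 \<le> n"
  obtains u v where "u \<in> verts G" "v \<in> verts G" "u \<noteq> v" "edges G = all_pairs (verts G) - {{u, v}}"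
proof -
  have G: "finite (verts G)" "edges G \<subseteq> all_pairs (verts G)" "card (verts G) = n"
    "card (edges G) = (n choose 2) - 1"
    using assms(1) simple_tt_graph_edges by (auto simp: tt_graphs_def simple_tt_graph_def)
  have "0 < n choose 2" using assms(2) by (simp add: zero_less_binomial)
  moreover have "card (all_pairs (verts G) - edges G) = (n choose 2) - ((n choose 2) - 1)"
    using G card_all_pairs[OF G(1)] finite_subset[OF G(2) finite_all_pairs[OF G(1)]]
    by (simp add: card_Diff_subset)
  ultimately have "card (all_pairs (verts G) - edges G) = 1" by linarith
  then obtain e where e: "all_pairs (verts G) - edges G = {e}" by (auto simp: card_1_singleton_iff)
  then obtain u v where "u \<in> verts G" "v \<in> verts G" "u \<noteq> v" "e = {u, v}"
    by (auto simp: all_pairs_def set_eq_iff) metis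
  moreover have "edges G = all_pairs (verts G) - {{u, v}}" using e G(2) \<open>e = {u, v}\<close> by blast
  ultimately show thesis using that by blast
qed

text \<open>Any bijection of the vertices can be corrected by a permutation so that it matches the five
  distinguished vertices in the given order; all other vertices look alike.\<close>
lemma tt_isomorphic_missing_nontarget_pair:
  assumes G: "simple_tt_graph G" "edges G = all_pairs (verts G) - {{x, y}}"
      "x \<in> verts G - targets G" "y \<in> verts G - targets G" "x \<noteq> y"
    and H: "simple_tt_graph H" "edges H = all_pairs (verts H) - {{x', y'}}"
      "x' \<in> verts H - targets H" "y' \<in> verts H - targets H" "x' \<noteq> y'"
    and card: "card (verts G) = card (verts H)"
  shows "tt_isomorphic G H"
proof -
  have fin: "finite (verts G)" "finite (verts H)"
    using G(1) H(1) by (auto simp: simple_tt_graph_def)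
  obtain h where h: "bij_betw h (verts G) (verts H)"
    using finite_same_card_bij[OF fin card] by blast
  let ?xs = "[target_r G, target_s G, target_t G, x, y]"
  let ?ys = "[target_r H, target_s H, target_t H, x', y']"
  have xs: "distinct ?xs" "set ?xs \<subseteq> verts G" and ys: "distinct ?ys" "set ?ys \<subseteq> verts H"
    using G H by (auto simp: simple_tt_graph_def targets_def)
  obtain \<pi> where \<pi>: "\<pi> permutes verts H" "map \<pi> (map h ?xs) = ?ys"
  proof (rule permutation_mapping_list[of "map h ?xs" ?ys "verts H"])
    have "inj_on h (set ?xs)" using h xs(2) unfolding bij_betw_def by (blast intro: inj_on_subset)
    then show "distinct (map h ?xs)" using xs(1) unfolding distinct_map by blast
    show "set (map h ?xs) \<subseteq> verts H" using h xs(2) by (auto simp: bij_betw_def)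
  qed (use ys in auto)
  let ?f = "\<pi> \<circ> h"
  have f: "bij_betw ?f (verts G) (verts H)"
    using h permutes_imp_bij[OF \<pi>(1)] by (rule bij_betw_trans)
  have inj: "?f u = ?f v \<longleftrightarrow> u = v" if "u \<in> verts G" "v \<in> verts G" for u v
    using f that unfolding bij_betw_def by (metis inj_on_eq_iff)
  have img: "?f u \<in> verts H" if "u \<in> verts G" for u
    using f that by (auto simp: bij_betw_def)
  have ends: "x' = ?f x" "y' = ?f y" using \<pi>(2) by auto
  have "{u, v} \<in> edges G \<longleftrightarrow> {?f u, ?f v} \<in> edges H" if "u \<in> verts G" "v \<in> verts G" for u v
    unfolding G(2) H(2) ends using G(3,4) that inj img by (simp add: doubleton_eq_iff del: o_apply)
  moreover have "?f ` targets G = targets H" using \<pi>(2) by (simp add: targets_def)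
  ultimately show ?thesis using f unfolding tt_isomorphic_def by blast
qed

text \<open>The pair is moved to two nontargets of the same graph, so that the comparison is between two
  subgraphs of one complete graph.\<close>
lemma less_reliable_than_missing_nontarget_pair:
  assumes G: "simple_tt_graph G" "5 \<le> card (verts G)"
    and uv: "u \<in> verts G" "v \<in> verts G" "u \<noteq> v" "edges G = all_pairs (verts G) - {{u, v}}"
    and target: "u \<in> targets G"
  obtains x y where "x \<in> verts G - targets G" "y \<in> verts G - targets G" "x \<noteq> y"
    and "\<And>p. p \<in> {0..1} \<Longrightarrow>
      reliability3 G p \<le> reliability3 (G\<lparr>edges := all_pairs (verts G) - {{x, y}}\<rparr>) p"
    and "\<And>p. 0 < p \<Longrightarrow> p < 1 \<Longrightarrow>
      reliability3 G p < reliability3 (G\<lparr>edges := all_pairs (verts G) - {{x, y}}\<rparr>) p"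
proof -
  have fin: "finite (verts G)" and tV: "targets G \<subseteq> verts G"
    using G(1) by (auto simp: simple_tt_graph_def)
  have card3: "card (targets G) = 3" using G(1) by (simp add: simple_tt_graph_def targets_def)
  have "2 \<le> card (verts G - targets G)"
    using G(2) card3 card_Diff_subset[of "targets G" "verts G"] tV fin finite_subset by fastforce
  then obtain B where "B \<subseteq> verts G - targets G" "card B = 2"
    by (meson obtain_subset_with_card_n)
  then obtain x0 y0 where xy0: "x0 \<in> verts G - targets G" "y0 \<in> verts G - targets G" "x0 \<noteq> y0"
    by (auto simp: card_2_iff)
  obtain r s t x y where T: "targets G = {r, s, t}" "distinct [r, s, t]"
    and xy: "x \<in> verts G - targets G" "y \<in> verts G - targets G" "x \<noteq> y"
    and uv': "{u, v} = {t, x} \<or> {u, v} = {r, s}"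
  proof (cases "v \<in> targets G")
    case True
    have "card (targets G - {u, v}) = 1"
      using True target uv(3) card3 by (subst card_Diff_subset) auto
    then obtain w where w: "targets G - {u, v} = {w}" by (auto simp: card_1_singleton_iff)
    then have "targets G = {u, v, w}" "distinct [u, v, w]" using True target uv(3) by auto
    then show thesis using that[of u v w x0 y0] xy0 by blast
  next
    case False
    have "card (targets G - {u}) = 2"
      using target card3 by (subst card_Diff_subset) auto
    then obtain r s where w: "targets G - {u} = {r, s}" "r \<noteq> s" by (auto simp: card_2_iff)
    then have "targets G = {r, s, u}" "distinct [r, s, u]" using target by auto
    moreover obtain y where "y \<in> verts G - targets G" "v \<noteq> y" using xy0 by (cases "v = x0") auto
    ultimately show thesis using that[of r s u v y] False uv(2) by blast
  qed
  let ?H = "G\<lparr>edges := all_pairs (verts G) - {{x, y}}\<rparr>"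
  have H: "simple_tt_graph ?H"
    using G(1) by (auto simp: simple_tt_graph_def targets_def all_pairs_def)
  have "targets ?H = {r, s, t}" using T(1) by (simp add: targets_def)
  note conn = targets_connected_iff_joined3[OF T(1)] targets_connected_iff_joined3[OF this]
  have rel: "reliability3 G p = expect (all_pairs (verts G) - {{u, v}}) p (\<lambda>F. of_bool (joined3 F r s t))"
    "reliability3 ?H p = expect (all_pairs (verts G) - {{x, y}}) p (\<lambda>F. of_bool (joined3 F r s t))"
    if "p \<in> {0..1}" for p
    using reliability3_eq_expect[OF G(1) that] reliability3_eq_expect[OF H that] uv(4)
    by (simp_all add: conn)
  have rstxy: "{r, s, t, x, y} \<subseteq> verts G" "distinct [r, s, t, x, y]"
    using T xy tV by auto
  note less = deleting_pair_at_target[OF fin rstxy]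
  have strict: "reliability3 G p < reliability3 ?H p" if "0 < p" "p < 1" for p
    using uv' less(2)[of p] less(4)[of p] that rel[of p] by auto
  have "reliability3 G p \<le> reliability3 ?H p" if p: "p \<in> {0..1}" for p
  proof (cases "p = 1")
    case False
    then show ?thesis using uv' less(1)[of p] less(3)[of p] p rel[of p] by auto
  next
    case True
    \<comment> \<open>At \<open>p = 1\<close> the pivotal probabilities say nothing, but the edges \<open>rs\<close> and \<open>st\<close> survive.\<close>
    have "{r, s} \<in> all_pairs (verts G) - {{x, y}}" "{s, t} \<in> all_pairs (verts G) - {{x, y}}"
      using rstxy by (auto simp: doubleton_eq_iff)
    then have "joined3 (all_pairs (verts G) - {{x, y}}) r s t"
      by (auto simp: joined3_def component_eq_iff intro: connected_using_edge)
    then show ?thesis using rel[OF p] True finite_all_pairs[OF fin] by (simp add: expect_1)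
  qed
  then show thesis using that[OF xy] strict by blast
qed

lemma Z_graph_props:
  assumes "5 \<le> n" "inj_on z {1..n}"
  shows "Z_graph n z \<in> tt_graphs n ((n choose 2) - 1)"
    and "edges (Z_graph n z) = all_pairs (verts (Z_graph n z)) - {{z 4, z 5}}"
    and "z 4 \<in> verts (Z_graph n z) - targets (Z_graph n z)"
    and "z 5 \<in> verts (Z_graph n z) - targets (Z_graph n z)" and "z 4 \<noteq> z 5"
proof -
  let ?V = "z ` {1..n}"
  have inj: "z i = z j \<longleftrightarrow> i = j" if "i \<in> {1..n}" "j \<in> {1..n}" for i j
    using assms(2) that by (auto simp: inj_on_eq_iff)
  have "{{z i, z j} | i j. 1 \<le> i \<and> i < j \<and> j \<le> n} = all_pairs ?V"
  proof
    show "{{z i, z j} | i j. 1 \<le> i \<and> i < j \<and> j \<le> n} \<subseteq> all_pairs ?V"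
      using inj by auto
    show "all_pairs ?V \<subseteq> {{z i, z j} | i j. 1 \<le> i \<and> i < j \<and> j \<le> n}"
    proof
      fix e assume "e \<in> all_pairs ?V"
      then obtain i j where ij: "i \<in> {1..n}" "j \<in> {1..n}" "i \<noteq> j" "e = {z i, z j}"
        unfolding all_pairs_def by blast
      then have "e = {z (min i j), z (max i j)}" "min i j < max i j"
        by (auto simp: min_def max_def insert_commute)
      then show "e \<in> {{z i, z j} | i j. 1 \<le> i \<and> i < j \<and> j \<le> n}"
        using ij(1,2) by (intro CollectI exI[of _ "min i j"] exI[of _ "max i j"]) auto
    qed
  qed
  then show edges: "edges (Z_graph n z) = all_pairs (verts (Z_graph n z)) - {{z 4, z 5}}"
    by (simp add: Z_graph_def)
  show ends: "z 4 \<in> verts (Z_graph n z) - targets (Z_graph n z)"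
    "z 5 \<in> verts (Z_graph n z) - targets (Z_graph n z)" "z 4 \<noteq> z 5"
    using assms(1) inj by (auto simp: Z_graph_def targets_def)
  have verts: "verts (Z_graph n z) = ?V" "card ?V = n"
    using assms(2) by (auto simp: Z_graph_def card_image)
  have "simple_tt_graph (Z_graph n z)"
    unfolding simple_tt_graph_def edges using assms(1) inj
    by (auto simp: Z_graph_def targets_def all_pairs_def)
  moreover have "card (edges (Z_graph n z)) = (n choose 2) - 1"
    unfolding edges using ends verts card_all_pairs[of ?V]
    by (subst card_Diff_singleton) auto
  ultimately show "Z_graph n z \<in> tt_graphs n ((n choose 2) - 1)"
    using verts by (simp add: tt_graphs_def)
qed

theorem theorem4p1:
  fixes n m :: nat and z :: "nat \<Rightarrow> 'a"
  assumes "n \<ge> 5" and "m = (n choose 2) - 1"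
    and "inj_on z {1..n}"
  shows "uniformly_most_reliable n m (Z_graph n z) \<and>
    (\<forall>G :: 'a tt_graph. uniformly_most_reliable n m G \<longrightarrow> tt_isomorphic G (Z_graph n z))"
proof -
  let ?Z = "Z_graph n z"
  note Z = Z_graph_props[OF assms(1,3), folded assms(2)]
  have simple: "simple_tt_graph G" "card (verts G) = n" if "G \<in> tt_graphs n m" for G :: "'a tt_graph"
    using that by (auto simp: tt_graphs_def)
  have iso: "tt_isomorphic G ?Z" if "G \<in> tt_graphs n m" "x \<in> verts G - targets G"
    "y \<in> verts G - targets G" "x \<noteq> y" "edges G = all_pairs (verts G) - {{x, y}}" for G :: "'a tt_graph" and x y
    using tt_isomorphic_missing_nontarget_pair[OF simple(1)[OF that(1)] that(5,2,3,4)
        simple(1)[OF Z(1)] Z(2-5)] simple(2)[OF that(1)] simple(2)[OF Z(1)] by simp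
  have iso_rel: "reliability3 G p = reliability3 ?Z p"
    if "G \<in> tt_graphs n m" "tt_isomorphic G ?Z" "p \<in> {0..1}" for G :: "'a tt_graph" and p
    using tt_isomorphic_reliability3_eq[OF simple(1)[OF that(1)] simple(1)[OF Z(1)] that(2,3)] .
  \<comment> \<open>The value \<open>1/2\<close> could be any point strictly between \<open>0\<close> and \<open>1\<close>.\<close>
  have dichotomy: "tt_isomorphic G ?Z \<or>
    (\<forall>p\<in>{0..1}. reliability3 G p \<le> reliability3 ?Z p) \<and> reliability3 G (1/2) < reliability3 ?Z (1/2)"
    if G: "G \<in> tt_graphs n m" for G :: "'a tt_graph"
  proof -
    obtain u v where uv: "u \<in> verts G" "v \<in> verts G" "u \<noteq> v" "edges G = all_pairs (verts G) - {{u, v}}"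
      using missing_pair[of G n] G assms(1,2) by auto
    show ?thesis
    proof (cases "u \<in> targets G \<or> v \<in> targets G")
      case False
      then show ?thesis using iso[OF G _ _ uv(3,4)] uv(1,2) by blast
    next
      case True
      then obtain u' v' where uv': "u' \<in> verts G" "v' \<in> verts G" "u' \<noteq> v'"
        "edges G = all_pairs (verts G) - {{u', v'}}" "u' \<in> targets G"
      proof (cases "u \<in> targets G")
        case True
        then show thesis using that[of u v] uv by blast
      next
        case False
        moreover have "edges G = all_pairs (verts G) - {{v, u}}"
          using uv(4) by (simp add: insert_commute)
        ultimately show thesis using that[of v u] uv(1-3) True by blast
      qed
      obtain x y where xy: "x \<in> verts G - targets G" "y \<in> verts G - targets G" "x \<noteq> y"
        and le: "\<And>p. p \<in> {0..1} \<Longrightarrow>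
          reliability3 G p \<le> reliability3 (G\<lparr>edges := all_pairs (verts G) - {{x, y}}\<rparr>) p"
        and less: "\<And>p. 0 < p \<Longrightarrow> p < 1 \<Longrightarrow>
          reliability3 G p < reliability3 (G\<lparr>edges := all_pairs (verts G) - {{x, y}}\<rparr>) p"
        using less_reliable_than_missing_nontarget_pair[OF simple(1)[OF G] _ uv'] simple(2)[OF G] assms(1)
        by blast
      let ?H = "G\<lparr>edges := all_pairs (verts G) - {{x, y}}\<rparr>"
      have fin: "finite (verts G)" using simple(1)[OF G] by (simp add: simple_tt_graph_def)
      have H: "?H \<in> tt_graphs n m"
        using G xy card_all_pairs[OF fin] assms(2)
        by (auto simp: tt_graphs_def simple_tt_graph_def targets_def all_pairs_def[symmetric] card_Diff_singleton)
      have "targets ?H = targets G" by (simp add: targets_def)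
      then have "tt_isomorphic ?H ?Z" using iso[OF H, of x y] xy by simp
      then have "reliability3 ?H p = reliability3 ?Z p" if "p \<in> {0..1}" for p
        using iso_rel[OF H] that by blast
      then show ?thesis using le less[of "1/2"] by auto
    qed
  qed
  have "reliability3 G p \<le> reliability3 ?Z p" if "G \<in> tt_graphs n m" "p \<in> {0..1}" for G :: "'a tt_graph" and p
    using dichotomy[OF that(1)] iso_rel[OF that(1) _ that(2)] that(2) by fastforce
  then have "uniformly_most_reliable n m ?Z"
    using Z(1) by (simp add: uniformly_most_reliable_def)
  moreover have "tt_isomorphic G ?Z" if "uniformly_most_reliable n m G" for G :: "'a tt_graph"
  proof -
    have "G \<in> tt_graphs n m" "reliability3 ?Z (1/2) \<le> reliability3 G (1/2)"
      using that Z(1) by (auto simp: uniformly_most_reliable_def)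
    then show ?thesis using dichotomy[of G] by auto
  qed
  ultimately show ?thesis by blast
qed

end
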